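(* Let $d\ge 1$, let $\sigma_{\min}\in(0,1)$ be fixed, let $\boldsymbol{x}_1\in\mathbb{R}^d$ be a data point, let $\boldsymbol{x}_0\sim\mathcal{N}(\boldsymbol{0},\boldsymbol{I})$ in $\mathbb{R}^d$, and let $t_m\in(0,1)$. Let $$\boldsymbol{x}_{t_m}=(1-t_m)\boldsymbol{x}_0+t_m(\boldsymbol{x}_1+\sigma_{\min}\boldsymbol{x}_0)$$ be the corresponding intermediate state on the conditional OT (CondOT) path. Then the path can be divided into two segments at $t_m$, and its flow and vector field are represented by piecewise functions; that is, for every $t\in[0,1]$, the CondOT flow $\boldsymbol{x}_t=(1-t)\boldsymbol{x}_0+t(\boldsymbol{x}_1+\sigma_{\min}\boldsymbol{x}_0)$ and the CondOT vector field $\boldsymbol{u}_t=(\boldsymbol{x}_1+\sigma_{\min}\boldsymbol{x}_0)-\boldsymbol{x}_0$ along it satisfy $$\boldsymbol{x}_t=\begin{cases}\left(1-\dfrac{t}{t_m}\right)\boldsymbol{x}_0+\dfrac{t}{t_m}\boldsymbol{x}_{t_m}, & \text{if } t<t_m,\\[8pt] \left(1-\dfrac{t-t_m}{1-t_m}\right)\boldsymbol{x}_{t_m}+\dfrac{t-t_m}{1-t_m}(\boldsymbol{x}_1+\sigma_{\min}\boldsymbol{x}_0), & \text{if } t\ge t_m,\end{cases}$$ $$\boldsymbol{u}_t=\begin{cases}\dfrac{1}{t_m}(\boldsymbol{x}_{t_m}-\boldsymbol{x}_0), & \text{if } t<t_m,\\[8pt] \dfrac{1}{1-t_m}(\boldsymbol{x}_1+\sigma_{\min}\boldsymbol{x}_0-\boldsymbol{x}_{t_m}),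 & \text{if } t\ge t_m.\end{cases}$$
   Context: Conditional OT (CondOT) paths: given a data sample $\boldsymbol{x}_1\in\mathbb{R}^d$, an initial noise sample $\boldsymbol{x}_0\sim\mathcal{N}(\boldsymbol{0},\boldsymbol{I})$ and a fixed small constant $\sigma_{\min}$, the conditional flow for $t\in[0,1]$ is $\boldsymbol{x}_t=\boldsymbol{\phi}_t(\boldsymbol{x}_0)=(1-t)\boldsymbol{x}_0+t(\boldsymbol{x}_1+\sigma_{\min}\boldsymbol{x}_0)$, and the conditional vector field (VF) along it, i.e. the time derivative of the flow, is $\boldsymbol{u}_t(\boldsymbol{x}_t\mid\boldsymbol{x}_1)=(\boldsymbol{x}_1+\sigma_{\min}\boldsymbol{x}_0)-\boldsymbol{x}_0$, abbreviated $\boldsymbol{u}_t$. *)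

theory Defs
  imports "HOL-Probability.Probability"
begin

definition std_gaussian_density :: "real ^ 'n \<Rightarrow> real" where
  "std_gaussian_density x = exp (- (norm x)\<^sup>2 / 2) / sqrt ((2 * pi) ^ CARD('n))"

lemma std_gaussian_density_eq_prod:
  fixes x :: "real ^ 'n"
  shows "std_gaussian_density x = (\<Prod>i\<in>UNIV. std_normal_density (x $ i))"
proof -
  have "(norm x)\<^sup>2 = (\<Sum>i\<in>UNIV. (x $ i)\<^sup>2)"
    by (simp add: norm_vec_def L2_set_def sum_nonneg)
  then show ?thesis
    by (simp add: std_gaussian_density_def std_normal_density_def prod_dividef
        sum_divide_distrib exp_sum real_sqrt_power real_sqrt_mult power_mult_distrib
        flip: sum_negf)
qed

lemma prob_space_std_gaussian:
  "prob_space (density lborel (\<lambda>x :: real ^ 'n. ennreal (std_gaussian_density x)))"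
proof
  have Basis: "(Basis :: (real ^ 'n) set) = range (\<lambda>i. axis i 1)"
    by (auto simp: Basis_vec_def)
  have inj: "inj (\<lambda>i :: 'n. axis i (1 :: real))"
    by (auto simp: inj_on_def axis_eq_axis)
  have eq: "ennreal (std_gaussian_density x) = (\<Prod>b\<in>Basis. ennreal (std_normal_density (x \<bullet> b)))"
    for x :: "real ^ 'n"
    unfolding Basis prod.reindex[OF inj]
    by (simp add: std_gaussian_density_eq_prod prod_ennreal inner_axis)
  have one: "(\<integral>\<^sup>+y. ennreal (std_normal_density y) \<partial>lborel) = 1"
    by (simp add: nn_integral_eq_integral)
  have "(\<integral>\<^sup>+x. ennreal (std_gaussian_density (x :: real ^ 'n)) \<partial>lborel) = 1"
    unfolding eq by (subst nn_integral_lborel_prod) (simp_all add: one)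
  moreover have "(\<lambda>x :: real ^ 'n. ennreal (std_gaussian_density x)) \<in> borel_measurable borel"
    unfolding std_gaussian_density_def by measurable
  ultimately show "emeasure (density lborel (\<lambda>x :: real ^ 'n. ennreal (std_gaussian_density x)))
      (space (density lborel (\<lambda>x :: real ^ 'n. ennreal (std_gaussian_density x)))) = 1"
    by (simp add: emeasure_density)
qed

definition condot_flow :: "real \<Rightarrow> real ^ 'n \<Rightarrow> real \<Rightarrow> real ^ 'n \<Rightarrow> real ^ 'n" where
  "condot_flow \<sigma>min x1 t x0 = (1 - t) *\<^sub>R x0 + t *\<^sub>R (x1 + \<sigma>min *\<^sub>R x0)"

text \<open>The vector field is taken along the trajectory: \<open>condot_vf \<sigma>min x1 t x0\<close> is its value at
  time \<open>t\<close> at the point \<open>condot_flow \<sigma>min x1 t x0\<close>, so the last argument is the initial noise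
  sample, not the current position. This value does not depend on \<open>t\<close>.\<close>

definition condot_vf :: "real \<Rightarrow> real ^ 'n \<Rightarrow> real \<Rightarrow> real ^ 'n \<Rightarrow> real ^ 'n" where
  "condot_vf \<sigma>min x1 t x0 = (x1 + \<sigma>min *\<^sub>R x0) - x0"

lemma condot_flow_has_vector_derivative:
  "((\<lambda>s. condot_flow \<sigma>min x1 s x0) has_vector_derivative condot_vf \<sigma>min x1 t x0) (at t within S)"
  unfolding condot_flow_def condot_vf_def
  by (auto intro!: derivative_eq_intros simp: algebra_simps)

end

theory Submission
  imports Defs
begin

text \<open>For each outcome the path is a straight line run at constant velocity: it sits at
  \<open>x0 + t *\<^sub>R v\<close>, where \<open>v\<close> is the value of the vector field
  (\<open>condot_flow_affine\<close>). Interpolating between two points of such a line gives the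
  point at the interpolated parameter (\<open>lerp_affine\<close>). So each piece is the same line,
  its time interval, from 0 to \<open>tm\<close> or from \<open>tm\<close> to 1, rescaled to unit
  length; its velocity is the displacement between the ends of the piece divided by its
  duration.\<close>

lemma condot_flow_affine:
  "condot_flow \<sigma>min x1 t x0 = x0 + t *\<^sub>R condot_vf \<sigma>min x1 s x0"
  by (simp add: condot_flow_def condot_vf_def algebra_simps)

lemma lerp_affine:
  fixes x v :: "'a :: real_vector"
  shows "(1 - c) *\<^sub>R (x + a *\<^sub>R v) + c *\<^sub>R (x + b *\<^sub>R v) = x + (a + c * (b - a)) *\<^sub>R v"
  by (simp add: algebra_simps)

theorem theorem2:
  fixes M :: "'a measure" and X0 :: "'a \<Rightarrow> real ^ 'n" and x1 :: "real ^ 'n"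
    and \<sigma>min tm :: real
  assumes "prob_space M"
    and "distributed M lborel X0 (\<lambda>x. ennreal (std_gaussian_density x))"
    and "0 < \<sigma>min" and "\<sigma>min < 1"
    and "0 < tm" and "tm < 1"
  shows "\<forall>t\<in>{0..1}. \<forall>\<omega>\<in>space M.
    (let x0 = X0 \<omega>; xtm = condot_flow \<sigma>min x1 tm x0 in
      condot_flow \<sigma>min x1 t x0 =
        (if t < tm
         then (1 - t / tm) *\<^sub>R x0 + (t / tm) *\<^sub>R xtm
         else (1 - (t - tm) / (1 - tm)) *\<^sub>R xtm
              + ((t - tm) / (1 - tm)) *\<^sub>R (x1 + \<sigma>min *\<^sub>R x0)) \<and>
      condot_vf \<sigma>min x1 t x0 =
        (if t < tm
         then (1 / tm) *\<^sub>R (xtm - x0)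
         else (1 / (1 - tm)) *\<^sub>R (x1 + \<sigma>min *\<^sub>R x0 - xtm)))"
proof (intro ballI)
  fix t \<omega>
  define x0 where "x0 = X0 \<omega>"
  define v where "v = condot_vf \<sigma>min x1 t x0"
  \<comment> \<open>\<open>v\<close> is the field at the fixed time \<open>t\<close>, while
    \<open>s\<close> is arbitrary: the second, free time in \<open>condot_flow_affine\<close> allows
    one \<open>v\<close> to serve for the whole path.\<close>
  have flow: "condot_flow \<sigma>min x1 s x0 = x0 + s *\<^sub>R v" for s
    unfolding v_def by (rule condot_flow_affine)
  \<comment> \<open>The end of the path is its point at parameter 1; the factor 1 is kept so that
    the term matches \<open>lerp_affine\<close> with \<open>b = 1\<close>.\<close>
  have endpoint: "x1 + \<sigma>min *\<^sub>R x0 = x0 + 1 *\<^sub>R v"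
    by (simp add: v_def condot_vf_def)
  have tm: "tm \<noteq> 0" "1 - tm \<noteq> 0"
    using assms by auto
  have first: "x0 + t *\<^sub>R v = (1 - t / tm) *\<^sub>R x0 + (t / tm) *\<^sub>R (x0 + tm *\<^sub>R v)"
    \<comment> \<open>The start \<open>x0\<close> is the point at parameter \<open>a = 0\<close>,
      and the coefficient \<open>t / tm * tm\<close> reduces to \<open>t\<close>.\<close>
    using lerp_affine[of "t / tm" x0 0 v tm] tm by simp
  have second: "x0 + t *\<^sub>R v = (1 - (t - tm) / (1 - tm)) *\<^sub>R (x0 + tm *\<^sub>R v)
      + ((t - tm) / (1 - tm)) *\<^sub>R (x0 + 1 *\<^sub>R v)"
    \<comment> \<open>With \<open>a = tm\<close> and \<open>b = 1\<close>, the coefficient of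
      \<open>v\<close> is \<open>tm + (t - tm) / (1 - tm) * (1 - tm)\<close>, which is
      \<open>t\<close>.\<close>
    unfolding lerp_affine using tm by simp
  have slope1: "v = (1 / tm) *\<^sub>R (x0 + tm *\<^sub>R v - x0)"
    using tm by simp
  have "x0 + 1 *\<^sub>R v - (x0 + tm *\<^sub>R v) = (1 - tm) *\<^sub>R v"
    by (simp add: algebra_simps)
  then have slope2: "v = (1 / (1 - tm)) *\<^sub>R (x0 + 1 *\<^sub>R v - (x0 + tm *\<^sub>R v))"
    using tm by simp
  show "let x0 = X0 \<omega>; xtm = condot_flow \<sigma>min x1 tm x0 in
      condot_flow \<sigma>min x1 t x0 =
        (if t < tm
         then (1 - t / tm) *\<^sub>R x0 + (t / tm) *\<^sub>R xtm
         else (1 - (t - tm) / (1 - tm)) *\<^sub>R xtm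
              + ((t - tm) / (1 - tm)) *\<^sub>R (x1 + \<sigma>min *\<^sub>R x0)) \<and>
      condot_vf \<sigma>min x1 t x0 =
        (if t < tm
         then (1 / tm) *\<^sub>R (xtm - x0)
         else (1 / (1 - tm)) *\<^sub>R (x1 + \<sigma>min *\<^sub>R x0 - xtm))"
    \<comment> \<open>Once everything is written in \<open>x0\<close> and \<open>v\<close>, the case
      distinction only selects among the four equations above.\<close>
    unfolding Let_def x0_def[symmetric] v_def[symmetric] flow endpoint
    using first second slope1 slope2 by presburger
qed

end
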